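(* Let $(\Gamma,v_0)$ be a pointed graph satisfying the following two conditions: (S1) for every $i\in I(\Gamma,v_0)$ and all $v,w\in V$, $|S_i(v)|=|S_i(w)|$; (S2) for all $i,j,k\in I(\Gamma,v_0)$ and all $v,w\in S_k(v_0)$, $|S_i(v)\cap S_j(v_0)|=|S_i(w)\cap S_j(v_0)|$. Then $(\Gamma,v_0)$ is hypergroup productive if and only if $DA_kA_l=DA_lA_k$ (as maps $\mathbb{C}^V\to\mathbb{C}^{I(\Gamma,v_0)}$) for all $k,l\in I(\Gamma,v_0)$.
   Context: All graphs $\Gamma$, with vertex set $V$, are simple, connected, locally finite, self-centered (all vertices have the same eccentricity, possibly infinite), and have at most countably many (possibly infinitely many) vertices. $d$ is the graph distance on $V$. A pointed graph $(\Gamma,v_0)$ is a graph with a chosen base point $v_0\in V$. For $v\in V$ and $k\in\mathbb{N}_0$, $S_k(v)=\{w\in V: d(v,w)=k\}$. Put $I(\Gamma,v_0)=\{d(v_0,v): v\in V\}$, which equals $\{0,1,\dots,\mathrm{diam}(\Gamma)\}$ if $V$ is finite and $\mathbb{N}_0$ if $V$ is infinite. Matrices: for $k\in I(\Gamma,v_0)$, $A^{(k)}=(\delta_{k,d(x,y)})_{x,y\in V}$ ($\delta$ is the Kronecker delta), $\mu_k=|S_k(v_0)|$, and $A_k=\frac{1}{\mu_k}A^{(k)}$. For a set $S$, $\mathbb{C}^S$ is the complex vector space of all families $(a_s)_{s\in S}$, $a_s\in\mathbb{C}$. By local finiteness each row of $A_k$ has finitely many nonzero entries, so $A_k$ acts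 linearly on $\mathbb{C}^V$ by $(A_k\bm{s})_x=\sum_{y\in V}A_k(x,y)s_y$. The linear map $D:\mathbb{C}^V\to\mathbb{C}^{I(\Gamma,v_0)}$ is $D(\bm{s})=\bigl(\sum_{v\in S_i(v_0)}s_v\bigr)_{i\in I(\Gamma,v_0)}$ for $\bm{s}=(s_v)_{v\in V}$. The algebra $H(\Gamma,v_0)$: let $H(\Gamma,v_0)=\{x_i\}_{i\in I(\Gamma,v_0)}$ be a set of indeterminates and $\mathbb{C}H(\Gamma,v_0)$ the free complex vector space on it. Define a bilinear operation (convolution) $\circ$ on $\mathbb{C}H(\Gamma,v_0)$ by $x_i\circ x_j=\sum_{k\in I(\Gamma,v_0)}p_{i,j}^k x_k$, where $$p_{i,j}^k=\frac{1}{|S_i(v_0)|}\sum_{v\in S_i(v_0)}\frac{|S_j(v)\cap S_k(v_0)|}{|S_j(v)|}.$$ Let $*$ be the conjugate-linear extension to $\mathbb{C}H(\Gamma,v_0)$ of the identity map on $H(\Gamma,v_0)$. Hermitian hypergroup: let $H=\{x_i\}_{i\in I}$ with $I=\{0,\dots,N\}$ or $I=\mathbb{N}_0$. A triple $(H,\circ,* )$, with $\circ:\mathbb{C}H\times\mathbb{C}H\to\mathbb{C}H$ and $*:\mathbb{C}H\to\mathbb{C}H$, is a discrete hypergroup if (1) $(\mathbb{C}H,\circ,* )$ is an (associative) $*$-algebra with unit $x_0$; (2) $*$ maps $H$ onto $H$; (3) writing $x_i\circ x_j=\sum_k q_{i,j}^k x_k$, one has $q_{i,j}^k\ge 0$,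 $\sum_k q_{i,j}^k=1$, and $q_{i,j}^0\ne 0$ if and only if $x_i=x_j^*$. It is hermitian if $*|_H$ is the identity map (then it is automatically commutative). $(\Gamma,v_0)$ is hypergroup productive if $(H(\Gamma,v_0),\circ,* )$ is a hermitian (discrete) hypergroup. *)

theory Defs
  imports Complex_Main "HOL-Library.Countable_Set" "HOL-Library.Extended_Nat"
    "HOL-Library.FuncSet" "HOL-Library.Poly_Mapping"
begin

section \<open>Pointed graphs\<close>

text \<open>
  A graph is given by its vertex set \<open>V\<close> and its adjacency relation \<open>E\<close>; an undirected edge
  is a symmetric pair of elements of \<open>E\<close>, and \<open>E ^^ n\<close> relates the end points of walks of
  length \<open>n\<close>.
\<close>

definition gdist :: "('a \<times> 'a) set \<Rightarrow> 'a \<Rightarrow> 'a \<Rightarrow> nat" where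
  "gdist E v w = (LEAST n. (v, w) \<in> E ^^ n)"

definition eccentricity :: "'a set \<Rightarrow> ('a \<times> 'a) set \<Rightarrow> 'a \<Rightarrow> enat" where
  "eccentricity V E v = (SUP w\<in>V. enat (gdist E v w))"

locale pointed_graph =
  fixes V :: "'a set" and E :: "('a \<times> 'a) set" and v\<^sub>0 :: 'a
  assumes edges_in_V: "E \<subseteq> V \<times> V"
    and edges_sym: "sym E"
    and edges_irrefl: "irrefl E"
    and connected: "\<And>v w. v \<in> V \<Longrightarrow> w \<in> V \<Longrightarrow> (v, w) \<in> E\<^sup>*"
    and locally_finite: "\<And>v. v \<in> V \<Longrightarrow> finite (E `` {v})"
    and countable_V: "countable V"
    and self_centered: "\<And>v w. v \<in> V \<Longrightarrow> w \<in> V \<Longrightarrow> eccentricity V E v = eccentricity V E w"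
    and base_in_V: "v\<^sub>0 \<in> V"

definition gsphere :: "'a set \<Rightarrow> ('a \<times> 'a) set \<Rightarrow> nat \<Rightarrow> 'a \<Rightarrow> 'a set" where
  "gsphere V E k v = {w \<in> V. gdist E v w = k}"

definition index_set :: "'a set \<Rightarrow> ('a \<times> 'a) set \<Rightarrow> 'a \<Rightarrow> nat set" where
  "index_set V E v\<^sub>0 = {gdist E v\<^sub>0 v | v. v \<in> V}"

definition cond_S1 :: "'a set \<Rightarrow> ('a \<times> 'a) set \<Rightarrow> 'a \<Rightarrow> bool" where
  "cond_S1 V E v\<^sub>0 \<longleftrightarrow>
    (\<forall>i\<in>index_set V E v\<^sub>0. \<forall>v\<in>V. \<forall>w\<in>V. card (gsphere V E i v) = card (gsphere V E i w))"

definition cond_S2 :: "'a set \<Rightarrow> ('a \<times> 'a) set \<Rightarrow> 'a \<Rightarrow> bool" where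
  "cond_S2 V E v\<^sub>0 \<longleftrightarrow>
    (\<forall>i\<in>index_set V E v\<^sub>0. \<forall>j\<in>index_set V E v\<^sub>0. \<forall>k\<in>index_set V E v\<^sub>0.
      \<forall>v\<in>gsphere V E k v\<^sub>0. \<forall>w\<in>gsphere V E k v\<^sub>0.
        card (gsphere V E i v \<inter> gsphere V E j v\<^sub>0) = card (gsphere V E i w \<inter> gsphere V E j v\<^sub>0))"


section \<open>The operators \<open>A\<^sub>k\<close> and \<open>D\<close>\<close>

text \<open>
  The space of complex families indexed by a set \<open>S\<close> is \<open>S \<rightarrow>\<^sub>E UNIV\<close>, the functions that are
  \<open>undefined\<close> outside \<open>S\<close>.
\<close>

definition dist_matrix :: "('a \<times> 'a) set \<Rightarrow> nat \<Rightarrow> 'a \<Rightarrow> 'a \<Rightarrow> complex" where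
  "dist_matrix E k x y = (if gdist E x y = k then 1 else 0)"

definition A_matrix :: "'a set \<Rightarrow> ('a \<times> 'a) set \<Rightarrow> 'a \<Rightarrow> nat \<Rightarrow> 'a \<Rightarrow> 'a \<Rightarrow> complex" where
  "A_matrix V E v\<^sub>0 k x y = 1 / of_nat (card (gsphere V E k v\<^sub>0)) * dist_matrix E k x y"

text \<open>
  Since \<open>sum\<close> is \<open>0\<close> on infinite index sets, the sum over \<open>V\<close> is restricted to the nonzero
  entries of the row, which are finitely many by local finiteness.
\<close>

definition A_op :: "'a set \<Rightarrow> ('a \<times> 'a) set \<Rightarrow> 'a \<Rightarrow> nat \<Rightarrow> ('a \<Rightarrow> complex) \<Rightarrow> ('a \<Rightarrow> complex)" where
  "A_op V E v\<^sub>0 k s =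
    (\<lambda>x\<in>V. \<Sum>y | y \<in> V \<and> A_matrix V E v\<^sub>0 k x y \<noteq> 0. A_matrix V E v\<^sub>0 k x y * s y)"

definition D_op :: "'a set \<Rightarrow> ('a \<times> 'a) set \<Rightarrow> 'a \<Rightarrow> ('a \<Rightarrow> complex) \<Rightarrow> (nat \<Rightarrow> complex)" where
  "D_op V E v\<^sub>0 s = (\<lambda>i\<in>index_set V E v\<^sub>0. \<Sum>v\<in>gsphere V E i v\<^sub>0. s v)"


section \<open>Discrete hypergroups\<close>

text \<open>
  The free complex vector space on \<open>{x\<^sub>i}\<close>, \<open>i \<in> I\<close>, consists of the finitely supported
  functions \<open>nat \<Rightarrow>\<^sub>0 complex\<close> with support in \<open>I\<close>; the indeterminate \<open>x\<^sub>i\<close> is the indicator of \<open>i\<close>.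
  The product that the library defines on \<open>nat \<Rightarrow>\<^sub>0 complex\<close> plays no role.
\<close>

definition free_space :: "nat set \<Rightarrow> (nat \<Rightarrow>\<^sub>0 complex) set" where
  "free_space I = {f. Poly_Mapping.keys f \<subseteq> I}"

definition xvar :: "nat \<Rightarrow> (nat \<Rightarrow>\<^sub>0 complex)" where
  "xvar i = Poly_Mapping.single i 1"

definition cscale :: "complex \<Rightarrow> (nat \<Rightarrow>\<^sub>0 complex) \<Rightarrow> (nat \<Rightarrow>\<^sub>0 complex)" where
  "cscale c f = Poly_Mapping.map ((*) c) f"

text \<open>\<open>W\<close> is a linear subspace of \<open>nat \<Rightarrow>\<^sub>0 complex\<close> serving as the carrier.\<close>

locale unital_star_algebra =
  fixes W :: "(nat \<Rightarrow>\<^sub>0 complex) set"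
    and conv :: "(nat \<Rightarrow>\<^sub>0 complex) \<Rightarrow> (nat \<Rightarrow>\<^sub>0 complex) \<Rightarrow> (nat \<Rightarrow>\<^sub>0 complex)"
    and star :: "(nat \<Rightarrow>\<^sub>0 complex) \<Rightarrow> (nat \<Rightarrow>\<^sub>0 complex)"
    and u :: "nat \<Rightarrow>\<^sub>0 complex"
  assumes zero_closed: "0 \<in> W"
    and add_closed: "\<And>f g. f \<in> W \<Longrightarrow> g \<in> W \<Longrightarrow> f + g \<in> W"
    and scale_closed: "\<And>c f. f \<in> W \<Longrightarrow> cscale c f \<in> W"
    and conv_closed: "\<And>f g. f \<in> W \<Longrightarrow> g \<in> W \<Longrightarrow> conv f g \<in> W"
    and conv_add_left: "\<And>f g h. f \<in> W \<Longrightarrow> g \<in> W \<Longrightarrow> h \<in> W \<Longrightarrow> conv (f + g) h = conv f h + conv g h"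
    and conv_add_right: "\<And>f g h. f \<in> W \<Longrightarrow> g \<in> W \<Longrightarrow> h \<in> W \<Longrightarrow> conv f (g + h) = conv f g + conv f h"
    and conv_scale_left: "\<And>c f g. f \<in> W \<Longrightarrow> g \<in> W \<Longrightarrow> conv (cscale c f) g = cscale c (conv f g)"
    and conv_scale_right: "\<And>c f g. f \<in> W \<Longrightarrow> g \<in> W \<Longrightarrow> conv f (cscale c g) = cscale c (conv f g)"
    and conv_assoc: "\<And>f g h. f \<in> W \<Longrightarrow> g \<in> W \<Longrightarrow> h \<in> W \<Longrightarrow> conv (conv f g) h = conv f (conv g h)"
    and unit_closed: "u \<in> W"
    and unit_left: "\<And>f. f \<in> W \<Longrightarrow> conv u f = f"
    and unit_right: "\<And>f. f \<in> W \<Longrightarrow> conv f u = f"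
    and star_closed: "\<And>f. f \<in> W \<Longrightarrow> star f \<in> W"
    and star_add: "\<And>f g. f \<in> W \<Longrightarrow> g \<in> W \<Longrightarrow> star (f + g) = star f + star g"
    and star_scale: "\<And>c f. f \<in> W \<Longrightarrow> star (cscale c f) = cscale (cnj c) (star f)"
    and star_star: "\<And>f. f \<in> W \<Longrightarrow> star (star f) = f"
    and star_conv: "\<And>f g. f \<in> W \<Longrightarrow> g \<in> W \<Longrightarrow> star (conv f g) = conv (star g) (star f)"

text \<open>
  The structure constants are the coefficients \<open>Poly_Mapping.lookup (conv (xvar i) (xvar j)) k\<close>.
\<close>

locale discrete_hypergroup =
  fixes I :: "nat set"
    and conv :: "(nat \<Rightarrow>\<^sub>0 complex) \<Rightarrow> (nat \<Rightarrow>\<^sub>0 complex) \<Rightarrow> (nat \<Rightarrow>\<^sub>0 complex)"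
    and star :: "(nat \<Rightarrow>\<^sub>0 complex) \<Rightarrow> (nat \<Rightarrow>\<^sub>0 complex)"
  assumes index_shape: "(\<exists>N. I = {0..N}) \<or> I = UNIV"
    and star_algebra: "unital_star_algebra (free_space I) conv star (xvar 0)"
    and star_basis: "star ` (xvar ` I) = xvar ` I"
    and coeff_nonneg: "\<And>i j k. i \<in> I \<Longrightarrow> j \<in> I \<Longrightarrow> k \<in> I \<Longrightarrow>
      Poly_Mapping.lookup (conv (xvar i) (xvar j)) k \<in> \<real> \<and>
      0 \<le> Re (Poly_Mapping.lookup (conv (xvar i) (xvar j)) k)"
    and coeff_sum: "\<And>i j. i \<in> I \<Longrightarrow> j \<in> I \<Longrightarrow>
      (\<Sum>k\<in>Poly_Mapping.keys (conv (xvar i) (xvar j)).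
        Poly_Mapping.lookup (conv (xvar i) (xvar j)) k) = 1"
    and coeff_zero: "\<And>i j. i \<in> I \<Longrightarrow> j \<in> I \<Longrightarrow>
      Poly_Mapping.lookup (conv (xvar i) (xvar j)) 0 \<noteq> 0 \<longleftrightarrow> xvar i = star (xvar j)"

locale hermitian_hypergroup = discrete_hypergroup +
  assumes star_id: "\<And>i. i \<in> I \<Longrightarrow> star (xvar i) = xvar i"


section \<open>The algebra of a pointed graph\<close>

definition p_coeff :: "'a set \<Rightarrow> ('a \<times> 'a) set \<Rightarrow> 'a \<Rightarrow> nat \<Rightarrow> nat \<Rightarrow> nat \<Rightarrow> real" where
  "p_coeff V E v\<^sub>0 i j k =
    1 / real (card (gsphere V E i v\<^sub>0)) *
    (\<Sum>v\<in>gsphere V E i v\<^sub>0.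
      real (card (gsphere V E j v \<inter> gsphere V E k v\<^sub>0)) / real (card (gsphere V E j v)))"

text \<open>
  For fixed \<open>i\<close> and \<open>j\<close> only finitely many \<open>p_coeff V E v\<^sub>0 i j k\<close> are nonzero, by local finiteness.
\<close>

definition basis_conv :: "'a set \<Rightarrow> ('a \<times> 'a) set \<Rightarrow> 'a \<Rightarrow> nat \<Rightarrow> nat \<Rightarrow> (nat \<Rightarrow>\<^sub>0 complex)" where
  "basis_conv V E v\<^sub>0 i j =
    (\<Sum>k | k \<in> index_set V E v\<^sub>0 \<and> p_coeff V E v\<^sub>0 i j k \<noteq> 0.
      cscale (complex_of_real (p_coeff V E v\<^sub>0 i j k)) (xvar k))"

definition graph_conv :: "'a set \<Rightarrow> ('a \<times> 'a) set \<Rightarrow> 'a \<Rightarrow>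
    (nat \<Rightarrow>\<^sub>0 complex) \<Rightarrow> (nat \<Rightarrow>\<^sub>0 complex) \<Rightarrow> (nat \<Rightarrow>\<^sub>0 complex)" where
  "graph_conv V E v\<^sub>0 f g =
    (\<Sum>i\<in>Poly_Mapping.keys f. \<Sum>j\<in>Poly_Mapping.keys g.
      cscale (Poly_Mapping.lookup f i * Poly_Mapping.lookup g j) (basis_conv V E v\<^sub>0 i j))"

definition graph_star :: "(nat \<Rightarrow>\<^sub>0 complex) \<Rightarrow> (nat \<Rightarrow>\<^sub>0 complex)" where
  "graph_star f = (\<Sum>i\<in>Poly_Mapping.keys f. cscale (cnj (Poly_Mapping.lookup f i)) (xvar i))"

definition hypergroup_productive :: "'a set \<Rightarrow> ('a \<times> 'a) set \<Rightarrow> 'a \<Rightarrow> bool" where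
  "hypergroup_productive V E v\<^sub>0 \<longleftrightarrow>
    hermitian_hypergroup (index_set V E v\<^sub>0) (graph_conv V E v\<^sub>0) graph_star"

end

theory Submission
  imports Defs
begin

text \<open>
  Under (S1) and (S2) the operator \<open>D A\<^sub>k\<close> factors through \<open>D\<close>: its \<open>i\<close>-th component is
  \<open>\<Sum>m. p\<^sub>m\<^sub>,\<^sub>k\<^sup>i (D s)\<^sub>m\<close>. As \<open>D\<close> is onto, \<open>D A\<^sub>k A\<^sub>l = D A\<^sub>l A\<^sub>k\<close> for all \<open>k, l\<close> amounts to
  \<open>(x\<^sub>j \<circ> x\<^sub>l) \<circ> x\<^sub>k = (x\<^sub>j \<circ> x\<^sub>k) \<circ> x\<^sub>l\<close> for all \<open>j, k, l\<close>. This holds in every commutative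
  associative algebra; conversely \<open>j = 0\<close> gives commutativity, and the two together give
  associativity. The remaining hypergroup axioms hold for every such graph.
\<close>

section \<open>Distances and spheres\<close>

context pointed_graph
begin

section \<open>Walks and the graph metric\<close>

lemma relpow_closed: "(v, w) \<in> E ^^ n \<Longrightarrow> v \<in> V \<Longrightarrow> w \<in> V"
  using edges_in_V by (induction n arbitrary: w) auto

text \<open>Connectedness supplies some walk, so the least walk length is attained.\<close>

lemma gdist_relpow:
  assumes "v \<in> V" "w \<in> V"
  shows "(v, w) \<in> E ^^ gdist E v w"
  unfolding gdist_def
proof (rule LeastI_ex)
  show "\<exists>n. (v, w) \<in> E ^^ n"
    using connected[OF assms] by (auto simp: rtrancl_power)
qed

lemma gdist_le: "(v, w) \<in> E ^^ n \<Longrightarrow> gdist E v w \<le> n"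
  unfolding gdist_def by (rule Least_le)

lemma gdist_refl [simp]: "gdist E v v = 0"
  using gdist_le[of v v 0] by simp

lemma gdist_eq_0_iff: "v \<in> V \<Longrightarrow> w \<in> V \<Longrightarrow> gdist E v w = 0 \<longleftrightarrow> v = w"
  using gdist_relpow[of v w] by auto

lemma relpow_sym: "(v, w) \<in> E ^^ n \<Longrightarrow> (w, v) \<in> E ^^ n"
proof (induction n arbitrary: w)
  case (Suc n)
  then obtain u where "(v, u) \<in> E ^^ n" "(u, w) \<in> E" by auto
  with Suc.IH edges_sym show ?case
    by (metis relpow_Suc_I2 symD)
qed simp

lemma gdist_commute:
  assumes "v \<in> V" "w \<in> V"
  shows "gdist E v w = gdist E w v"
  using assms gdist_le[OF relpow_sym[OF gdist_relpow]] by (simp add: antisym)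

lemma gdist_triangle:
  assumes "u \<in> V" "v \<in> V" "w \<in> V"
  shows "gdist E u w \<le> gdist E u v + gdist E v w"
  using assms by (intro gdist_le) (auto simp: relpow_add intro: gdist_relpow)

text \<open>Every vertex at distance \<open>k\<close> ends a walk of length \<open>k\<close>; by
  local finiteness and induction on \<open>k\<close> there are finitely many such ends.\<close>

lemma finite_gsphere [simp, intro]:
  assumes "v \<in> V"
  shows "finite (gsphere V E k v)"
proof (rule finite_subset)
  show "gsphere V E k v \<subseteq> (E ^^ k) `` {v}"
    using assms gdist_relpow by (auto simp: gsphere_def)
  show "finite ((E ^^ k) `` {v})"
  proof (induction k)
    case (Suc k)
    have "(E ^^ Suc k) `` {v} = (\<Union>u\<in>(E ^^ k) `` {v}. E `` {u})" by auto
    also have "finite \<dots>"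
      using Suc assms locally_finite relpow_closed by (intro finite_UN_I) blast+
    finally show ?case .
  qed simp
qed

lemma gsphere_subset: "gsphere V E k v \<subseteq> V"
  by (auto simp: gsphere_def)

section \<open>The shape of the index set\<close>

lemma index_set_iff: "k \<in> index_set V E v\<^sub>0 \<longleftrightarrow> gsphere V E k v\<^sub>0 \<noteq> {}"
  by (auto simp: index_set_def gsphere_def)

lemma zero_in_index_set [simp]: "0 \<in> index_set V E v\<^sub>0"
  using base_in_V gdist_refl[of v\<^sub>0] by (force simp: index_set_def)

text \<open>Cut a shortest walk to a vertex at distance \<open>k\<close> after \<open>j\<close>
  steps. The cut vertex is at most \<open>j\<close> away from the base point and at most
  \<open>k - j\<close> from the end, so the triangle inequality forces equality.\<close>

lemma index_set_downward:
  assumes "k \<in> index_set V E v\<^sub>0" "j \<le> k"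
  shows "j \<in> index_set V E v\<^sub>0"
proof -
  from assms obtain v where v: "v \<in> V" "k = gdist E v\<^sub>0 v"
    by (auto simp: index_set_def)
  have "(v\<^sub>0, v) \<in> E ^^ (j + (k - j))"
    using gdist_relpow[OF base_in_V v(1)] v assms by simp
  then obtain w where w: "(v\<^sub>0, w) \<in> E ^^ j" "(w, v) \<in> E ^^ (k - j)"
    by (auto simp only: relpow_add)
  then have "w \<in> V"
    using relpow_closed base_in_V by blast
  moreover have "k \<le> gdist E v\<^sub>0 w + gdist E w v"
    using gdist_triangle[OF base_in_V \<open>w \<in> V\<close> v(1)] v by simp
  then have "gdist E v\<^sub>0 w = j"
    using w[THEN gdist_le] assms(2) by linarith
  ultimately show ?thesis
    by (auto simp: index_set_def)
qed

lemma index_set_shape: "(\<exists>N. index_set V E v\<^sub>0 = {0..N}) \<or> index_set V E v\<^sub>0 = UNIV"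
proof (cases "finite (index_set V E v\<^sub>0)")
  case True
  have "index_set V E v\<^sub>0 = {0..Max (index_set V E v\<^sub>0)}"
  proof (intro equalityI subsetI)
    fix k assume "k \<in> {0..Max (index_set V E v\<^sub>0)}"
    moreover have "Max (index_set V E v\<^sub>0) \<in> index_set V E v\<^sub>0"
      using True zero_in_index_set by (intro Max_in) blast+
    ultimately show "k \<in> index_set V E v\<^sub>0"
      using index_set_downward by auto
  qed (use True in auto)
  then show ?thesis by blast
next
  case False
  have "k \<in> index_set V E v\<^sub>0" for k
    using False index_set_downward by (meson infinite_nat_iff_unbounded_le)
  then show ?thesis by blast
qed

end


section \<open>The convolution product on coefficients\<close>

lemma lookup_cscale [simp]: "Poly_Mapping.lookup (cscale c f) k = c * Poly_Mapping.lookup f k"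
  by (simp add: cscale_def Poly_Mapping.map.rep_eq when_def)

lemma keys_cscale: "Poly_Mapping.keys (cscale c f) \<subseteq> Poly_Mapping.keys f"
  by (auto simp: in_keys_iff)

lemma lookup_xvar: "Poly_Mapping.lookup (xvar i) k = (if k = i then 1 else 0)"
  by (simp add: xvar_def lookup_single when_def)

lemma keys_xvar [simp]: "Poly_Mapping.keys (xvar i) = {i}"
  by (simp add: xvar_def)

lemma xvar_eq_iff [simp]: "xvar i = xvar j \<longleftrightarrow> i = j"
  by (metis keys_xvar singleton_inject)

lemma keys_subset_atMost:
  fixes f :: "nat \<Rightarrow>\<^sub>0 complex"
  obtains N where "Poly_Mapping.keys f \<subseteq> {..N}"
proof
  \<comment> \<open>\<open>Max\<close> of an empty support is unspecified, but the inclusion is then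
    trivial.\<close>
  show "Poly_Mapping.keys f \<subseteq> {..Max (Poly_Mapping.keys f)}" by auto
qed

lemma lookup_graph_star [simp]:
  "Poly_Mapping.lookup (graph_star f) k = cnj (Poly_Mapping.lookup f k)"
proof -
  have "Poly_Mapping.lookup (graph_star f) k =
      (\<Sum>i\<in>Poly_Mapping.keys f. if i = k then cnj (Poly_Mapping.lookup f i) else 0)"
    unfolding graph_star_def lookup_sum by (intro sum.cong) (auto simp: lookup_xvar)
  then show ?thesis
    by (simp add: in_keys_iff)
qed

lemma keys_graph_star [simp]: "Poly_Mapping.keys (graph_star f) = Poly_Mapping.keys f"
  by (auto simp: in_keys_iff)

lemma graph_star_xvar [simp]: "graph_star (xvar i) = xvar i"
  by (intro poly_mapping_eqI) (simp add: lookup_xvar)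

context pointed_graph
begin

section \<open>Structure constants and their support\<close>

abbreviation "p \<equiv> p_coeff V E v\<^sub>0"

lemma p_nonneg: "0 \<le> p i j k"
  unfolding p_coeff_def by (intro mult_nonneg_nonneg sum_nonneg) auto

text \<open>An empty \<open>S_i(v_0)\<close> leaves nothing to sum, and an empty
  \<open>S_k(v_0)\<close> makes every intersection empty. Hence sums over initial segments of the
  naturals can replace sums over the index set.\<close>

lemma p_eq_0:
  assumes "i \<notin> index_set V E v\<^sub>0 \<or> k \<notin> index_set V E v\<^sub>0"
  shows "p i j k = 0"
  using assms by (auto simp: p_coeff_def index_set_iff)

lemma p_nonzeroE:
  assumes "p i j k \<noteq> 0"
  obtains v w where "v \<in> V" "w \<in> V" "gdist E v\<^sub>0 v = i" "gdist E v w = j" "gdist E v\<^sub>0 w = k"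
proof -
  have "\<exists>v\<in>gsphere V E i v\<^sub>0. gsphere V E j v \<inter> gsphere V E k v\<^sub>0 \<noteq> {}"
    using assms by (force simp: p_coeff_def intro: sum.neutral)
  then show ?thesis
    by (auto simp: gsphere_def intro: that)
qed

text \<open>A nonzero constant comes from a triangle \<open>v_0\<close>, \<open>v\<close>,
  \<open>w\<close> with side lengths \<open>i\<close>, \<open>j\<close>, \<open>k\<close>. The first
  bound makes products finitely supported; the second bounds the left index when the other two are
  given.\<close>

lemma p_nonzero_le:
  assumes "p i j k \<noteq> 0"
  shows "k \<le> i + j" "i \<le> k + j"
proof -
  from assms obtain v w
    where vw: "v \<in> V" "w \<in> V" "gdist E v\<^sub>0 v = i" "gdist E v w = j" "gdist E v\<^sub>0 w = k"
    by (rule p_nonzeroE)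
  show "k \<le> i + j"
    using gdist_triangle[OF base_in_V vw(1,2)] vw by simp
  show "i \<le> k + j"
    using gdist_triangle[OF base_in_V vw(2,1)] gdist_commute[OF vw(1,2)] vw by simp
qed

lemma lookup_basis_conv [simp]:
  "Poly_Mapping.lookup (basis_conv V E v\<^sub>0 i j) k = complex_of_real (p i j k)"
proof -
  \<comment> \<open>Without finiteness the sum defining \<open>basis_conv\<close> would default to
    0.\<close>
  have fin: "finite {k. k \<in> index_set V E v\<^sub>0 \<and> p i j k \<noteq> 0}"
  proof (rule finite_subset)
    show "{k. k \<in> index_set V E v\<^sub>0 \<and> p i j k \<noteq> 0} \<subseteq> {..i + j}"
      using p_nonzero_le(1) by auto
  qed simp
  have "Poly_Mapping.lookup (basis_conv V E v\<^sub>0 i j) k =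
      (\<Sum>m | m \<in> index_set V E v\<^sub>0 \<and> p i j m \<noteq> 0.
        if m = k then complex_of_real (p i j m) else 0)"
    unfolding basis_conv_def lookup_sum by (intro sum.cong) (auto simp: lookup_xvar)
  also have "\<dots> = complex_of_real (p i j k)"
    using fin p_eq_0[of i k j] by (subst sum.delta) auto
  finally show ?thesis .
qed

section \<open>The product in coordinates\<close>

abbreviation "conv \<equiv> graph_conv V E v\<^sub>0"

text \<open>Enlarging the supports adds only zero terms. The free choice of \<open>A\<close> and
  \<open>B\<close> gives several elements common summation ranges.\<close>

lemma lookup_conv:
  assumes "finite A" "finite B" "Poly_Mapping.keys f \<subseteq> A" "Poly_Mapping.keys g \<subseteq> B"
  shows "Poly_Mapping.lookup (conv f g) k =
    (\<Sum>i\<in>A. \<Sum>j\<in>B. Poly_Mapping.lookup f i * Poly_Mapping.lookup g j * complex_of_real (p i j k))"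
proof -
  have "Poly_Mapping.lookup (conv f g) k =
    (\<Sum>i\<in>Poly_Mapping.keys f. \<Sum>j\<in>Poly_Mapping.keys g.
      Poly_Mapping.lookup f i * Poly_Mapping.lookup g j * complex_of_real (p i j k))"
    by (simp add: graph_conv_def lookup_sum)
  also have "\<dots> = (\<Sum>i\<in>Poly_Mapping.keys f. \<Sum>j\<in>B.
      Poly_Mapping.lookup f i * Poly_Mapping.lookup g j * complex_of_real (p i j k))"
    using assms by (intro sum.cong sum.mono_neutral_left) (auto simp: in_keys_iff)
  also have "\<dots> = (\<Sum>i\<in>A. \<Sum>j\<in>B.
      Poly_Mapping.lookup f i * Poly_Mapping.lookup g j * complex_of_real (p i j k))"
    using assms by (intro sum.mono_neutral_left) (auto simp: in_keys_iff intro!: sum.neutral)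
  finally show ?thesis .
qed

lemma lookup_conv_xvar [simp]:
  "Poly_Mapping.lookup (conv (xvar i) (xvar j)) k = complex_of_real (p i j k)"
  by (subst lookup_conv[of "{i}" "{j}"]) (auto simp: lookup_xvar)

lemma lookup_conv_eq_0:
  assumes "k \<notin> index_set V E v\<^sub>0"
  shows "Poly_Mapping.lookup (conv f g) k = 0"
  by (subst lookup_conv[OF finite_keys finite_keys order_refl order_refl])
    (simp add: p_eq_0 assms)

lemma conv_in_free_space: "conv f g \<in> free_space (index_set V E v\<^sub>0)"
  using lookup_conv_eq_0 by (auto simp: free_space_def in_keys_iff)

text \<open>The product of \<open>x_i\<close> and \<open>x_j\<close> is supported in
  \<open>{..i + j}\<close>, so any larger bound serves and one \<open>N\<close> can be shared by
  several products.\<close>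

lemma lookup_conv_conv_xvar:
  assumes "i + j \<le> N"
  shows "Poly_Mapping.lookup (conv (conv (xvar i) (xvar j)) (xvar l)) r =
    complex_of_real (\<Sum>m\<le>N. p i j m * p m l r)"
proof -
  have keys: "Poly_Mapping.keys (conv (xvar i) (xvar j)) \<subseteq> {..N}"
    using assms p_nonzero_le(1)[of i j] by (fastforce simp: in_keys_iff)
  show ?thesis
    by (subst lookup_conv[OF _ _ keys, of "{l}"]) (auto simp: lookup_xvar)
qed

section \<open>Bilinearity\<close>

lemma conv_add_left: "conv (f + g) h = conv f h + conv g h"
proof (intro poly_mapping_eqI)
  fix k
  \<comment> \<open>Cancellation can shrink the support of \<open>f + g\<close>, so all three
    products are expanded over this union.\<close>
  let ?A = "Poly_Mapping.keys f \<union> Poly_Mapping.keys g" and ?B = "Poly_Mapping.keys h"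
  have "Poly_Mapping.keys (f + g) \<subseteq> ?A" by (rule keys_add)
  then show "Poly_Mapping.lookup (conv (f + g) h) k = Poly_Mapping.lookup (conv f h + conv g h) k"
    by (simp add: lookup_add lookup_conv[of ?A ?B] algebra_simps sum.distrib)
qed

lemma conv_add_right: "conv f (g + h) = conv f g + conv f h"
proof (intro poly_mapping_eqI)
  fix k
  let ?A = "Poly_Mapping.keys f" and ?B = "Poly_Mapping.keys g \<union> Poly_Mapping.keys h"
  have "Poly_Mapping.keys (g + h) \<subseteq> ?B" by (rule keys_add)
  then show "Poly_Mapping.lookup (conv f (g + h)) k = Poly_Mapping.lookup (conv f g + conv f h) k"
    by (simp add: lookup_add lookup_conv[of ?A ?B] algebra_simps sum.distrib)
qed

lemma conv_scale_left: "conv (cscale c f) g = cscale c (conv f g)"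
  by (intro poly_mapping_eqI)
    (simp add: lookup_conv[of "Poly_Mapping.keys f" "Poly_Mapping.keys g"] keys_cscale
      sum_distrib_left mult_ac)

lemma conv_scale_right: "conv f (cscale c g) = cscale c (conv f g)"
  by (intro poly_mapping_eqI)
    (simp add: lookup_conv[of "Poly_Mapping.keys f" "Poly_Mapping.keys g"] keys_cscale
      sum_distrib_left mult_ac)

section \<open>The unit\<close>

lemma p_unit_left:
  assumes "j \<in> index_set V E v\<^sub>0"
  shows "p 0 j k = (if k = j then 1 else 0)"
proof -
  have "gsphere V E 0 v\<^sub>0 = {v\<^sub>0}"
    using base_in_V by (auto simp: gsphere_def gdist_eq_0_iff)
  moreover have "card (gsphere V E j v\<^sub>0) \<noteq> 0"
    using assms base_in_V by (simp add: index_set_iff)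
  moreover have "gsphere V E j v\<^sub>0 \<inter> gsphere V E k v\<^sub>0 = {}" if "k \<noteq> j"
    using that by (auto simp: gsphere_def)
  ultimately show ?thesis
    by (simp add: p_coeff_def)
qed

lemma p_unit_right:
  assumes "i \<in> index_set V E v\<^sub>0"
  shows "p i 0 k = (if k = i then 1 else 0)"
proof -
  have S0: "gsphere V E 0 v = {v}" if "v \<in> gsphere V E i v\<^sub>0" for v
    using that by (auto simp: gsphere_def gdist_eq_0_iff)
  have "gsphere V E 0 v \<inter> gsphere V E k v\<^sub>0 = (if k = i then {v} else {})"
    if "v \<in> gsphere V E i v\<^sub>0" for v
    unfolding S0[OF that] using that by (auto simp: gsphere_def)
  with S0 have "p i 0 k = 1 / real (card (gsphere V E i v\<^sub>0)) *
      (\<Sum>v\<in>gsphere V E i v\<^sub>0. if k = i then 1 else 0)"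
    unfolding p_coeff_def by (intro arg_cong2[where f = "(*)"] sum.cong) auto
  moreover have "card (gsphere V E i v\<^sub>0) \<noteq> 0"
    using assms base_in_V by (simp add: index_set_iff)
  ultimately show ?thesis by simp
qed

lemma conv_unit_left:
  assumes "f \<in> free_space (index_set V E v\<^sub>0)"
  shows "conv (xvar 0) f = f"
proof (intro poly_mapping_eqI)
  fix k
  have "Poly_Mapping.lookup (conv (xvar 0) f) k =
      (\<Sum>j\<in>Poly_Mapping.keys f. Poly_Mapping.lookup f j * complex_of_real (p 0 j k))"
    by (subst lookup_conv[of "{0}" "Poly_Mapping.keys f"]) (auto simp: lookup_xvar)
  also have "\<dots> = (\<Sum>j\<in>Poly_Mapping.keys f. if k = j then Poly_Mapping.lookup f j else 0)"
    using assms by (intro sum.cong) (auto simp: free_space_def p_unit_left)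
  finally show "Poly_Mapping.lookup (conv (xvar 0) f) k = Poly_Mapping.lookup f k"
    by (simp add: in_keys_iff)
qed

lemma conv_unit_right:
  assumes "f \<in> free_space (index_set V E v\<^sub>0)"
  shows "conv f (xvar 0) = f"
proof (intro poly_mapping_eqI)
  fix k
  have "Poly_Mapping.lookup (conv f (xvar 0)) k =
      (\<Sum>j\<in>Poly_Mapping.keys f. Poly_Mapping.lookup f j * complex_of_real (p j 0 k))"
    by (subst lookup_conv[of "Poly_Mapping.keys f" "{0}"]) (auto simp: lookup_xvar)
  also have "\<dots> = (\<Sum>j\<in>Poly_Mapping.keys f. if k = j then Poly_Mapping.lookup f j else 0)"
    using assms by (intro sum.cong) (auto simp: free_space_def p_unit_right)
  finally show "Poly_Mapping.lookup (conv f (xvar 0)) k = Poly_Mapping.lookup f k"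
    by (simp add: in_keys_iff)
qed

section \<open>Commutation identities extended from basis elements to all elements\<close>

lemma conv_commute:
  assumes "f \<in> free_space (index_set V E v\<^sub>0)" "g \<in> free_space (index_set V E v\<^sub>0)"
    and "\<And>i j k. i \<in> index_set V E v\<^sub>0 \<Longrightarrow> j \<in> index_set V E v\<^sub>0 \<Longrightarrow> p i j k = p j i k"
  shows "conv f g = conv g f"
proof (intro poly_mapping_eqI)
  fix k
  let ?f = "Poly_Mapping.lookup f" and ?g = "Poly_Mapping.lookup g"
  have "Poly_Mapping.lookup (conv f g) k =
      (\<Sum>i\<in>Poly_Mapping.keys f. \<Sum>j\<in>Poly_Mapping.keys g. ?f i * ?g j * complex_of_real (p i j k))"
    by (rule lookup_conv) auto
  also have "\<dots> =
      (\<Sum>i\<in>Poly_Mapping.keys f. \<Sum>j\<in>Poly_Mapping.keys g. ?g j * ?f i * complex_of_real (p j i k))"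
    using assms by (intro sum.cong refl) (auto simp: free_space_def subset_iff)
  also have "\<dots> =
      (\<Sum>j\<in>Poly_Mapping.keys g. \<Sum>i\<in>Poly_Mapping.keys f. ?g j * ?f i * complex_of_real (p j i k))"
    by (rule sum.swap)
  also have "\<dots> = Poly_Mapping.lookup (conv g f) k"
    by (rule lookup_conv[symmetric]) auto
  finally show "Poly_Mapping.lookup (conv f g) k = Poly_Mapping.lookup (conv g f) k" .
qed

text \<open>Trilinearity written out: the innermost sum is the coefficient at \<open>r\<close> of
  the triple product of \<open>x_i\<close>, \<open>x_j\<close>, \<open>x_l\<close>. It runs to
  \<open>2 * N\<close> because support bounds add under the product.\<close>

lemma lookup_conv_conv:
  assumes f: "Poly_Mapping.keys f \<subseteq> {..N}" and g: "Poly_Mapping.keys g \<subseteq> {..N}"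
    and h: "Poly_Mapping.keys h \<subseteq> {..N}"
  shows "Poly_Mapping.lookup (conv (conv f g) h) r =
    (\<Sum>i\<le>N. \<Sum>j\<le>N. \<Sum>l\<le>N.
      Poly_Mapping.lookup f i * Poly_Mapping.lookup g j * Poly_Mapping.lookup h l *
      complex_of_real (\<Sum>m\<le>2 * N. p i j m * p m l r))"
proof -
  let ?f = "Poly_Mapping.lookup f" and ?g = "Poly_Mapping.lookup g" and ?h = "Poly_Mapping.lookup h"
  have lookup_fg: "Poly_Mapping.lookup (conv f g) m =
      (\<Sum>i\<le>N. \<Sum>j\<le>N. ?f i * ?g j * complex_of_real (p i j m))" for m
    using f g by (intro lookup_conv) auto
  have fg: "Poly_Mapping.keys (conv f g) \<subseteq> {..2 * N}"
  proof
    fix m assume "m \<in> Poly_Mapping.keys (conv f g)"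
    then have "\<exists>i\<le>N. \<exists>j\<le>N. p i j m \<noteq> 0"
      unfolding in_keys_iff lookup_fg by (force intro: sum.neutral)
    then obtain i j where "i \<le> N" "j \<le> N" "p i j m \<noteq> 0" by blast
    then show "m \<in> {..2 * N}"
      using p_nonzero_le(1)[of i j m] by simp
  qed
  have "Poly_Mapping.lookup (conv (conv f g) h) r =
      (\<Sum>m\<le>2 * N. \<Sum>l\<le>N. (\<Sum>i\<le>N. \<Sum>j\<le>N. ?f i * ?g j * complex_of_real (p i j m)) * ?h l *
        complex_of_real (p m l r))"
    using lookup_conv[OF _ _ fg h, of r] by (simp add: lookup_fg)
  also have "\<dots> = (\<Sum>m\<le>2 * N. \<Sum>l\<le>N. \<Sum>i\<le>N. \<Sum>j\<le>N.
      ?f i * ?g j * ?h l * complex_of_real (p i j m * p m l r))"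
    by (simp add: sum_distrib_right sum_distrib_left mult_ac)
  \<comment> \<open>The interchanges first move \<open>l\<close> inside \<open>i\<close> and
    \<open>j\<close>, then carry \<open>m\<close> past all three.\<close>
  also have "\<dots> = (\<Sum>m\<le>2 * N. \<Sum>i\<le>N. \<Sum>j\<le>N. \<Sum>l\<le>N.
      ?f i * ?g j * ?h l * complex_of_real (p i j m * p m l r))"
    by (subst sum.swap[of _ "{..N}" "{..N}"], subst (2) sum.swap) simp
  also have "\<dots> = (\<Sum>i\<le>N. \<Sum>m\<le>2 * N. \<Sum>j\<le>N. \<Sum>l\<le>N.
      ?f i * ?g j * ?h l * complex_of_real (p i j m * p m l r))"
    by (rule sum.swap)
  also have "\<dots> = (\<Sum>i\<le>N. \<Sum>j\<le>N. \<Sum>m\<le>2 * N. \<Sum>l\<le>N.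
      ?f i * ?g j * ?h l * complex_of_real (p i j m * p m l r))"
    by (intro sum.cong refl sum.swap)
  also have "\<dots> = (\<Sum>i\<le>N. \<Sum>j\<le>N. \<Sum>l\<le>N. \<Sum>m\<le>2 * N.
      ?f i * ?g j * ?h l * complex_of_real (p i j m * p m l r))"
    by (intro sum.cong refl sum.swap)
  finally show ?thesis
    by (simp add: sum_distrib_left)
qed

text \<open>Both sides are trilinear, and a common support bound lets both be expanded over the same
  ranges and compared term by term.\<close>

lemma conv_right_commute:
  assumes "f \<in> free_space (index_set V E v\<^sub>0)" "g \<in> free_space (index_set V E v\<^sub>0)"
    "h \<in> free_space (index_set V E v\<^sub>0)"
    and "\<And>i j l. i \<in> index_set V E v\<^sub>0 \<Longrightarrow> j \<in> index_set V E v\<^sub>0 \<Longrightarrow> l \<in> index_set V E v\<^sub>0 \<Longrightarrow>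
      conv (conv (xvar i) (xvar j)) (xvar l) = conv (conv (xvar i) (xvar l)) (xvar j)"
  shows "conv (conv f g) h = conv (conv f h) g"
proof (intro poly_mapping_eqI)
  fix r
  let ?f = "Poly_Mapping.lookup f" and ?g = "Poly_Mapping.lookup g" and ?h = "Poly_Mapping.lookup h"
  obtain N1 N2 N3 where "Poly_Mapping.keys f \<subseteq> {..N1}" "Poly_Mapping.keys g \<subseteq> {..N2}"
    "Poly_Mapping.keys h \<subseteq> {..N3}"
    by (metis keys_subset_atMost)
  then have N: "Poly_Mapping.keys f \<subseteq> {..N1 + N2 + N3}" "Poly_Mapping.keys g \<subseteq> {..N1 + N2 + N3}"
    "Poly_Mapping.keys h \<subseteq> {..N1 + N2 + N3}"
    by force+
  define N where "N = N1 + N2 + N3"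
  have "?f i * ?g j * ?h l * complex_of_real (\<Sum>m\<le>2 * N. p i j m * p m l r) =
      ?f i * ?h l * ?g j * complex_of_real (\<Sum>m\<le>2 * N. p i l m * p m j r)"
    if "i \<le> N" "j \<le> N" "l \<le> N" for i j l
  proof (cases "i \<in> index_set V E v\<^sub>0 \<and> j \<in> index_set V E v\<^sub>0 \<and> l \<in> index_set V E v\<^sub>0")
    case True
    then have "Poly_Mapping.lookup (conv (conv (xvar i) (xvar j)) (xvar l)) r =
        Poly_Mapping.lookup (conv (conv (xvar i) (xvar l)) (xvar j)) r"
      using assms(4) by simp
    then show ?thesis
      using that by (simp add: lookup_conv_conv_xvar[where N = "2 * N"] mult_ac del: of_real_sum)
  next
    case False
    then have "?f i = 0 \<or> ?g j = 0 \<or> ?h l = 0"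
      using assms(1-3) by (auto simp: free_space_def subset_iff in_keys_iff)
    then show ?thesis by auto
  qed
  then have "(\<Sum>i\<le>N. \<Sum>j\<le>N. \<Sum>l\<le>N.
        ?f i * ?g j * ?h l * complex_of_real (\<Sum>m\<le>2 * N. p i j m * p m l r)) =
      (\<Sum>i\<le>N. \<Sum>j\<le>N. \<Sum>l\<le>N.
        ?f i * ?h l * ?g j * complex_of_real (\<Sum>m\<le>2 * N. p i l m * p m j r))"
    by (intro sum.cong refl) auto
  \<comment> \<open>In the expansion of \<open>conv (conv f h) g\<close> the index of
    \<open>h\<close> precedes that of \<open>g\<close>.\<close>
  also have "\<dots> = (\<Sum>i\<le>N. \<Sum>l\<le>N. \<Sum>j\<le>N.
        ?f i * ?h l * ?g j * complex_of_real (\<Sum>m\<le>2 * N. p i l m * p m j r))"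
    by (intro sum.cong refl sum.swap)
  finally show "Poly_Mapping.lookup (conv (conv f g) h) r = Poly_Mapping.lookup (conv (conv f h) g) r"
    using N[folded N_def] by (simp only: lookup_conv_conv[of _ N])
qed

section \<open>The coefficient at the unit, and spheres cut into layers\<close>

lemma p_zero_iff:
  assumes "i \<in> index_set V E v\<^sub>0"
  shows "p i j 0 \<noteq> 0 \<longleftrightarrow> i = j"
proof
  assume "p i j 0 \<noteq> 0"
  then show "i = j"
    using p_nonzeroE base_in_V gdist_commute by (metis gdist_eq_0_iff)
next
  assume "i = j"
  have "gsphere V E 0 v\<^sub>0 = {v\<^sub>0}"
    using base_in_V by (auto simp: gsphere_def gdist_eq_0_iff)
  \<comment> \<open>By symmetry of the distance, \<open>v_0\<close> is at distance \<open>i\<close>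
    from each \<open>v\<close> in \<open>S_i(v_0)\<close>, so no summand vanishes.\<close>
  moreover have "gsphere V E i v \<inter> {v\<^sub>0} = {v\<^sub>0}" if "v \<in> gsphere V E i v\<^sub>0" for v
    using that base_in_V gdist_commute by (auto simp: gsphere_def)
  ultimately have "p i i 0 = 1 / real (card (gsphere V E i v\<^sub>0)) *
      (\<Sum>v\<in>gsphere V E i v\<^sub>0. 1 / real (card (gsphere V E i v)))"
    by (simp add: p_coeff_def)
  moreover have "(\<Sum>v\<in>gsphere V E i v\<^sub>0. 1 / real (card (gsphere V E i v))) > 0"
  proof (rule sum_pos)
    fix v assume "v \<in> gsphere V E i v\<^sub>0"
    then have "v \<in> V" "v\<^sub>0 \<in> gsphere V E i v"
      using base_in_V gdist_commute by (auto simp: gsphere_def)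
    then show "1 / real (card (gsphere V E i v)) > 0"
      by (auto simp: card_gt_0_iff)
  qed (use assms base_in_V in \<open>auto simp: index_set_iff\<close>)
  moreover have "card (gsphere V E i v\<^sub>0) \<noteq> 0"
    using assms base_in_V by (simp add: index_set_iff)
  ultimately show "p i j 0 \<noteq> 0"
    using \<open>i = j\<close> by simp
qed

text \<open>By the triangle inequality the disjoint spheres of radius at most \<open>i + j\<close>
  around the base point cover \<open>S_j(v)\<close>.\<close>

lemma sum_card_Int_gsphere:
  assumes "v \<in> gsphere V E i v\<^sub>0"
  shows "(\<Sum>k\<le>i + j. card (gsphere V E j v \<inter> gsphere V E k v\<^sub>0)) = card (gsphere V E j v)"
proof -
  have v: "v \<in> V" using assms by (auto simp: gsphere_def)
  have "gsphere V E j v = (\<Union>k\<le>i + j. gsphere V E j v \<inter> gsphere V E k v\<^sub>0)"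
    using assms gdist_triangle[OF base_in_V v] by (fastforce simp: gsphere_def)
  then have "card (gsphere V E j v) = card (\<Union>k\<le>i + j. gsphere V E j v \<inter> gsphere V E k v\<^sub>0)"
    by simp
  also have "\<dots> = (\<Sum>k\<le>i + j. card (gsphere V E j v \<inter> gsphere V E k v\<^sub>0))"
    using v by (intro card_UN_disjoint ballI finite_Int) (auto, auto simp: gsphere_def)
  finally show ?thesis by simp
qed

end


section \<open>Graphs satisfying (S1) and (S2)\<close>

locale sphere_regular_graph = pointed_graph +
  assumes S1: "cond_S1 V E v\<^sub>0" and S2: "cond_S2 V E v\<^sub>0"
begin

section \<open>Structure constants under the regularity conditions\<close>

lemma card_gsphere:
  assumes "i \<in> index_set V E v\<^sub>0" "v \<in> V"
  shows "card (gsphere V E i v) = card (gsphere V E i v\<^sub>0)"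
  using S1 assms base_in_V unfolding cond_S1_def by blast

lemma card_gsphere_nonzero:
  assumes "i \<in> index_set V E v\<^sub>0"
  shows "card (gsphere V E i v\<^sub>0) \<noteq> 0"
  using assms base_in_V by (simp add: index_set_iff)

text \<open>In the average defining \<open>p\<close>, (S2) makes the numerators and (S1) the
  denominators independent of the vertex of \<open>S_i(v_0)\<close>, so any one vertex computes it.
  For \<open>k\<close> out of range, where (S2) says nothing, both sides are 0.\<close>

lemma p_eq:
  assumes "j \<in> index_set V E v\<^sub>0" "v \<in> gsphere V E i v\<^sub>0"
  shows "p i j k = card (gsphere V E j v \<inter> gsphere V E k v\<^sub>0) / card (gsphere V E j v\<^sub>0)"
proof (cases "k \<in> index_set V E v\<^sub>0")
  case True
  have i: "i \<in> index_set V E v\<^sub>0"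
    using assms(2) by (auto simp: index_set_iff)
  have "p i j k = 1 / real (card (gsphere V E i v\<^sub>0)) *
      (\<Sum>w\<in>gsphere V E i v\<^sub>0.
        card (gsphere V E j v \<inter> gsphere V E k v\<^sub>0) / card (gsphere V E j v\<^sub>0))"
    unfolding p_coeff_def
  proof (intro arg_cong2[where f = "(*)"] sum.cong refl
      arg_cong2[where f = "(/)"] arg_cong[where f = real])
    fix w assume w: "w \<in> gsphere V E i v\<^sub>0"
    show "card (gsphere V E j w \<inter> gsphere V E k v\<^sub>0) = card (gsphere V E j v \<inter> gsphere V E k v\<^sub>0)"
      using S2 assms True i w unfolding cond_S2_def by blast
    show "card (gsphere V E j w) = card (gsphere V E j v\<^sub>0)"
      using card_gsphere[OF assms(1)] w gsphere_subset by blast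
  qed
  then show ?thesis
    using card_gsphere_nonzero[OF i] by simp
next
  case False
  then show ?thesis
    using p_eq_0[of i k j] by (auto simp: index_set_iff)
qed

lemma sum_p:
  assumes "i \<in> index_set V E v\<^sub>0" "j \<in> index_set V E v\<^sub>0"
  shows "(\<Sum>k\<le>i + j. p i j k) = 1"
proof -
  obtain v where v: "v \<in> gsphere V E i v\<^sub>0"
    using assms by (auto simp: index_set_iff)
  then have "v \<in> V" using gsphere_subset by blast
  have "(\<Sum>k\<le>i + j. p i j k) =
      real (\<Sum>k\<le>i + j. card (gsphere V E j v \<inter> gsphere V E k v\<^sub>0)) / card (gsphere V E j v\<^sub>0)"
    by (simp add: p_eq[OF assms(2) v] sum_divide_distrib)
  then show ?thesis
    using card_gsphere_nonzero[OF assms(2)]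
    by (simp add: sum_card_Int_gsphere[OF v] card_gsphere[OF assms(2) \<open>v \<in> V\<close>] del: of_nat_sum)
qed

section \<open>Hypergroup axioms and right commutation of basis elements\<close>

lemma hypergroup_productive_iff:
  "hypergroup_productive V E v\<^sub>0 \<longleftrightarrow>
    (\<forall>j\<in>index_set V E v\<^sub>0. \<forall>k\<in>index_set V E v\<^sub>0. \<forall>l\<in>index_set V E v\<^sub>0.
      conv (conv (xvar j) (xvar l)) (xvar k) = conv (conv (xvar j) (xvar k)) (xvar l))"
  (is "_ \<longleftrightarrow> ?rhs")
proof
  assume "hypergroup_productive V E v\<^sub>0"
  then interpret hermitian_hypergroup "index_set V E v\<^sub>0" conv graph_star
    unfolding hypergroup_productive_def .
  interpret unital_star_algebra "free_space (index_set V E v\<^sub>0)" conv graph_star "xvar 0"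
    by (rule star_algebra)
  have xvar_closed: "xvar i \<in> free_space (index_set V E v\<^sub>0)" if "i \<in> index_set V E v\<^sub>0" for i
    using that by (simp add: free_space_def)
  have commute: "conv (xvar i) (xvar j) = conv (xvar j) (xvar i)"
    if "i \<in> index_set V E v\<^sub>0" "j \<in> index_set V E v\<^sub>0" for i j
  proof -
    \<comment> \<open>Real structure constants make the involution fix this product, while the
      axioms make it reverse the factors.\<close>
    have "conv (xvar i) (xvar j) = graph_star (conv (xvar i) (xvar j))"
      by (intro poly_mapping_eqI) simp
    also have "\<dots> = conv (xvar j) (xvar i)"
      using that by (simp add: star_conv xvar_closed)
    finally show ?thesis .
  qed
  \<comment> \<open>By associativity both sides become \<open>x_j\<close> times a product of
    \<open>x_k\<close> and \<open>x_l\<close>, in the two orders.\<close>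
  show ?rhs
    using commute by (simp add: conv_assoc xvar_closed)
next
  assume rhs: ?rhs
  have p_commute: "p i j k = p j i k"
    if "i \<in> index_set V E v\<^sub>0" "j \<in> index_set V E v\<^sub>0" for i j k
  proof -
    \<comment> \<open>With the unit as left factor, right commutation becomes commutativity.\<close>
    have "conv (conv (xvar 0) (xvar i)) (xvar j) = conv (conv (xvar 0) (xvar j)) (xvar i)"
      using rhs that by simp
    then have "conv (xvar i) (xvar j) = conv (xvar j) (xvar i)"
      using that by (simp add: conv_unit_left free_space_def)
    then show ?thesis
      using lookup_conv_xvar[of i j k] lookup_conv_xvar[of j i k] by simp
  qed
  show "hypergroup_productive V E v\<^sub>0"
    unfolding hypergroup_productive_def
  proof unfold_locales
    fix f g h
    assume f: "f \<in> free_space (index_set V E v\<^sub>0)" and g: "g \<in> free_space (index_set V E v\<^sub>0)"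
      and h: "h \<in> free_space (index_set V E v\<^sub>0)"
    \<comment> \<open>The chain is \<open>(f g) h = (g f) h = (g h) f = f (g h)\<close>: right
      commutation in the middle, commutativity at both ends.\<close>
    have "conv (conv f g) h = conv (conv g f) h"
      by (simp add: conv_commute[OF f g p_commute])
    also have "\<dots> = conv (conv g h) f"
      using rhs by (intro conv_right_commute[OF g f h]) blast
    also have "\<dots> = conv f (conv g h)"
      by (rule conv_commute[OF conv_in_free_space f p_commute])
    finally show "conv (conv f g) h = conv f (conv g h)" .
  next
    fix f g
    assume f: "f \<in> free_space (index_set V E v\<^sub>0)" and g: "g \<in> free_space (index_set V E v\<^sub>0)"
    \<comment> \<open>Real structure constants make the involution multiplicative; commutativity
      then supplies the reversed order.\<close>
    have "graph_star (conv f g) = conv (graph_star f) (graph_star g)"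
      by (intro poly_mapping_eqI)
        (simp add: lookup_conv[of "Poly_Mapping.keys f" "Poly_Mapping.keys g"])
    also have "\<dots> = conv (graph_star g) (graph_star f)"
      using f g by (intro conv_commute p_commute) (auto simp: free_space_def)
    finally show "graph_star (conv f g) = conv (graph_star g) (graph_star f)" .
  next
    fix i j assume ij: "i \<in> index_set V E v\<^sub>0" "j \<in> index_set V E v\<^sub>0"
    have "(\<Sum>k\<in>Poly_Mapping.keys (conv (xvar i) (xvar j)).
        Poly_Mapping.lookup (conv (xvar i) (xvar j)) k) =
        (\<Sum>k\<le>i + j. Poly_Mapping.lookup (conv (xvar i) (xvar j)) k)"
      using p_nonzero_le(1) by (intro sum.mono_neutral_left) (auto simp: in_keys_iff)
    also have "\<dots> = complex_of_real (\<Sum>k\<le>i + j. p i j k)"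
      by simp
    finally show "(\<Sum>k\<in>Poly_Mapping.keys (conv (xvar i) (xvar j)).
        Poly_Mapping.lookup (conv (xvar i) (xvar j)) k) = 1"
      by (simp add: sum_p[OF ij] del: of_real_sum)
  next
    show "graph_star ` xvar ` index_set V E v\<^sub>0 = xvar ` index_set V E v\<^sub>0"
      by (simp add: image_image)
  next
    fix f g assume "f \<in> free_space (index_set V E v\<^sub>0)" "g \<in> free_space (index_set V E v\<^sub>0)"
    then show "f + g \<in> free_space (index_set V E v\<^sub>0)"
      using keys_add[of f g] by (auto simp: free_space_def)
  next
    fix c f assume "f \<in> free_space (index_set V E v\<^sub>0)"
    then show "cscale c f \<in> free_space (index_set V E v\<^sub>0)"
      using keys_cscale by (auto simp: free_space_def)
  next
    fix f g show "graph_star (f + g) = graph_star f + graph_star g"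
      by (intro poly_mapping_eqI) (simp add: lookup_add)
  next
    fix c f show "graph_star (cscale c f) = cscale (cnj c) (graph_star f)"
      by (intro poly_mapping_eqI) simp
  next
    fix f show "graph_star (graph_star f) = f"
      by (intro poly_mapping_eqI) simp
  qed (simp_all add: conv_add_left conv_add_right conv_scale_left conv_scale_right
      conv_unit_left conv_unit_right conv_in_free_space index_set_shape p_nonneg p_zero_iff,
      simp_all add: free_space_def)
qed

section \<open>The operators in terms of structure constants\<close>

lemma A_op_apply:
  assumes "k \<in> index_set V E v\<^sub>0" "x \<in> V"
  shows "A_op V E v\<^sub>0 k s x = (\<Sum>y\<in>gsphere V E k x. s y) / of_nat (card (gsphere V E k v\<^sub>0))"
proof -
  \<comment> \<open>As the sphere size is nonzero, no entry at distance \<open>k\<close> is lost by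
    keeping only nonzero entries.\<close>
  have "{y \<in> V. A_matrix V E v\<^sub>0 k x y \<noteq> 0} = gsphere V E k x"
    using card_gsphere_nonzero[OF assms(1)]
    by (auto simp: A_matrix_def dist_matrix_def gsphere_def simp del: card_eq_0_iff)
  moreover have "A_matrix V E v\<^sub>0 k x y = 1 / of_nat (card (gsphere V E k v\<^sub>0))"
    if "y \<in> gsphere V E k x" for y
    using that by (simp add: A_matrix_def dist_matrix_def gsphere_def)
  ultimately show ?thesis
    using assms(2) by (simp add: A_op_def sum_divide_distrib)
qed

text \<open>Double counting of pairs \<open>(v, y)\<close> with \<open>v\<close> in
  \<open>S_i(v_0)\<close> at distance \<open>k\<close> from \<open>y\<close>: each
  \<open>s y\<close> occurs once for every \<open>v\<close> in the intersection of
  \<open>S_k(y)\<close> and \<open>S_i(v_0)\<close>. For \<open>y\<close> in \<open>S_m(v_0)\<close>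
  this number, divided by the size of \<open>S_k(v_0)\<close>, is \<open>p m k i\<close>.\<close>

lemma D_A_op:
  assumes "k \<in> index_set V E v\<^sub>0" "i \<in> index_set V E v\<^sub>0" "i + k \<le> N"
  shows "D_op V E v\<^sub>0 (A_op V E v\<^sub>0 k s) i =
    (\<Sum>m\<le>N. complex_of_real (p m k i) * (\<Sum>y\<in>gsphere V E m v\<^sub>0. s y))"
proof -
  let ?n = "of_nat (card (gsphere V E k v\<^sub>0)) :: complex"
  \<comment> \<open>This ball contains every \<open>S_k(v)\<close> in question because
    \<open>i + k \<le> N\<close>. It is a finite range for \<open>y\<close> independent of
    \<open>v\<close>, which permits the interchange of sums.\<close>
  define B where "B = (\<Union>m\<le>N. gsphere V E m v\<^sub>0)"
  have fin: "finite B"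
    using base_in_V by (auto simp: B_def)
  have sphere_B: "gsphere V E k v = {y\<in>B. v \<in> gsphere V E k y}" if "v \<in> gsphere V E i v\<^sub>0" for v
  proof -
    have v: "v \<in> V" "gdist E v\<^sub>0 v = i" using that by (auto simp: gsphere_def)
    have "gdist E v\<^sub>0 y \<le> N" if "y \<in> V" "gdist E v y = k" for y
      using gdist_triangle[OF base_in_V v(1) that(1)] v that assms(3) by simp
    then show ?thesis
      using v gdist_commute by (auto simp: gsphere_def B_def)
  qed
  have "D_op V E v\<^sub>0 (A_op V E v\<^sub>0 k s) i =
      (\<Sum>v\<in>gsphere V E i v\<^sub>0. (\<Sum>y\<in>gsphere V E k v. s y) / ?n)"
    using assms gsphere_subset[of i v\<^sub>0]
    by (auto simp: D_op_def A_op_apply subset_iff intro!: sum.cong)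
  also have "\<dots> = (\<Sum>v\<in>gsphere V E i v\<^sub>0. \<Sum>y\<in>{y\<in>B. v \<in> gsphere V E k y}. s y / ?n)"
    by (intro sum.cong) (auto simp: sphere_B sum_divide_distrib)
  also have "\<dots> = (\<Sum>y\<in>B. \<Sum>v\<in>{v\<in>gsphere V E i v\<^sub>0. v \<in> gsphere V E k y}. s y / ?n)"
    using fin base_in_V by (intro sum.swap_restrict) auto
  also have "\<dots> = (\<Sum>y\<in>B. of_nat (card (gsphere V E k y \<inter> gsphere V E i v\<^sub>0)) / ?n * s y)"
    by (intro sum.cong) (auto simp: Int_def conj_commute)
  also have "\<dots> = (\<Sum>m\<le>N. \<Sum>y\<in>gsphere V E m v\<^sub>0.
      of_nat (card (gsphere V E k y \<inter> gsphere V E i v\<^sub>0)) / ?n * s y)"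
    unfolding B_def using base_in_V
    by (intro sum.UNION_disjoint ballI finite_gsphere) (auto simp: gsphere_def)
  also have "\<dots> = (\<Sum>m\<le>N. \<Sum>y\<in>gsphere V E m v\<^sub>0. complex_of_real (p m k i) * s y)"
    using assms(1) by (intro sum.cong refl) (simp add: p_eq)
  finally show ?thesis
    by (simp add: sum_distrib_left)
qed

text \<open>Apply \<open>D_A_op\<close> twice: summing \<open>p j l m * p m k i\<close> over the
  intermediate radius \<open>m\<close> gives a coefficient of a triple product. The operator applied
  last contributes the right-hand factor.\<close>

lemma D_A_A_op:
  assumes "k \<in> index_set V E v\<^sub>0" "l \<in> index_set V E v\<^sub>0" "i \<in> index_set V E v\<^sub>0" "i + k + l \<le> N"
  shows "D_op V E v\<^sub>0 (A_op V E v\<^sub>0 k (A_op V E v\<^sub>0 l s)) i =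
    (\<Sum>j\<le>N. Poly_Mapping.lookup (conv (conv (xvar j) (xvar l)) (xvar k)) i *
      (\<Sum>y\<in>gsphere V E j v\<^sub>0. s y))"
proof -
  have inner: "complex_of_real (p m k i) * (\<Sum>y\<in>gsphere V E m v\<^sub>0. A_op V E v\<^sub>0 l s y) =
      (\<Sum>j\<le>N. complex_of_real (p j l m * p m k i) * (\<Sum>y\<in>gsphere V E j v\<^sub>0. s y))" for m
  proof (cases "p m k i = 0")
    case False
    \<comment> \<open>A nonzero \<open>p m k i\<close> forces \<open>m \<le> i + k\<close>, hence
      \<open>m + l \<le> N\<close>, as the second use of \<open>D_A_op\<close> requires.\<close>
    then have m: "m \<in> index_set V E v\<^sub>0" "m + l \<le> N"
      using p_eq_0[of m i k] p_nonzero_le[OF False] assms(4) by auto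
    then have "(\<Sum>y\<in>gsphere V E m v\<^sub>0. A_op V E v\<^sub>0 l s y) = D_op V E v\<^sub>0 (A_op V E v\<^sub>0 l s) m"
      by (simp add: D_op_def)
    then show ?thesis
      by (simp add: D_A_op[OF assms(2) m] sum_distrib_left mult_ac)
  qed simp
  \<comment> \<open>The range for \<open>m\<close> is \<open>N + l\<close> because
    \<open>lookup_conv_conv_xvar\<close> needs a bound on \<open>j + l\<close> for every
    \<open>j \<le> N\<close>.\<close>
  have "D_op V E v\<^sub>0 (A_op V E v\<^sub>0 k (A_op V E v\<^sub>0 l s)) i =
      (\<Sum>m\<le>N + l. \<Sum>j\<le>N. complex_of_real (p j l m * p m k i) * (\<Sum>y\<in>gsphere V E j v\<^sub>0. s y))"
    using assms by (subst D_A_op[where N = "N + l"]) (auto simp only: inner)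
  also have "\<dots> = (\<Sum>j\<le>N. \<Sum>m\<le>N + l.
      complex_of_real (p j l m * p m k i) * (\<Sum>y\<in>gsphere V E j v\<^sub>0. s y))"
    by (rule sum.swap)
  also have "\<dots> = (\<Sum>j\<le>N. Poly_Mapping.lookup (conv (conv (xvar j) (xvar l)) (xvar k)) i *
      (\<Sum>y\<in>gsphere V E j v\<^sub>0. s y))"
    by (intro sum.cong refl)
      (simp add: lookup_conv_conv_xvar[where N = "N + l"] sum_distrib_right)
  finally show ?thesis .
qed

lemma D_A_A_op_commute_iff:
  assumes k: "k \<in> index_set V E v\<^sub>0" and l: "l \<in> index_set V E v\<^sub>0"
  shows "(\<forall>s\<in>V \<rightarrow>\<^sub>E (UNIV :: complex set).
      D_op V E v\<^sub>0 (A_op V E v\<^sub>0 k (A_op V E v\<^sub>0 l s)) =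
      D_op V E v\<^sub>0 (A_op V E v\<^sub>0 l (A_op V E v\<^sub>0 k s))) \<longleftrightarrow>
    (\<forall>j\<in>index_set V E v\<^sub>0.
      conv (conv (xvar j) (xvar l)) (xvar k) = conv (conv (xvar j) (xvar k)) (xvar l))"
    (is "?L \<longleftrightarrow> ?R")
proof
  assume L: ?L
  show ?R
  proof (intro ballI poly_mapping_eqI)
    fix j i assume "j \<in> index_set V E v\<^sub>0"
    then obtain z where z: "z \<in> V" "gdist E v\<^sub>0 z = j"
      by (auto simp: index_set_def)
    show "Poly_Mapping.lookup (conv (conv (xvar j) (xvar l)) (xvar k)) i =
        Poly_Mapping.lookup (conv (conv (xvar j) (xvar k)) (xvar l)) i"
    proof (cases "i \<in> index_set V E v\<^sub>0")
      case True
      \<comment> \<open>The indicator of one vertex of \<open>S_j(v_0)\<close>, which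
        \<open>D_op\<close> sends to the unit family at \<open>j\<close>.\<close>
      define s :: "'a \<Rightarrow> complex" where "s = (\<lambda>v\<in>V. if v = z then 1 else 0)"
      \<comment> \<open>Adding \<open>j\<close> keeps that index inside \<open>{..N}\<close>, so
        \<open>pick\<close> finds it; the other terms are what \<open>D_A_A_op\<close>
        requires.\<close>
      define N where "N = i + k + l + j"
      have s_sum: "(\<Sum>y\<in>gsphere V E m v\<^sub>0. s y) = (if m = j then 1 else 0)" for m
      proof -
        have "(\<Sum>y\<in>gsphere V E m v\<^sub>0. s y) = (\<Sum>y\<in>gsphere V E m v\<^sub>0. if y = z then 1 else 0)"
          using gsphere_subset by (intro sum.cong) (auto simp: s_def)
        then show ?thesis
          using z base_in_V by (simp add: sum.delta) (simp add: gsphere_def)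
      qed
      have pick: "(\<Sum>m\<le>N. c m * (if m = j then 1 else 0)) = c j" for c :: "nat \<Rightarrow> complex"
        by (simp add: N_def if_distrib[of "(*) _"] cong: if_cong)
      have N: "i + k + l \<le> N" "i + l + k \<le> N"
        by (simp_all add: N_def)
      have "s \<in> V \<rightarrow>\<^sub>E UNIV" by (simp add: s_def)
      then have "D_op V E v\<^sub>0 (A_op V E v\<^sub>0 k (A_op V E v\<^sub>0 l s)) i =
          D_op V E v\<^sub>0 (A_op V E v\<^sub>0 l (A_op V E v\<^sub>0 k s)) i"
        using L by simp
      then show ?thesis
        using True k l by (simp add: D_A_A_op[where N = N] s_sum pick N)
    next
      case False
      then show ?thesis
        by (simp add: lookup_conv_eq_0)
    qed
  qed
next
  assume R: ?R
  show ?L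
  proof (intro ballI ext)
    fix s :: "'a \<Rightarrow> complex" and i
    show "D_op V E v\<^sub>0 (A_op V E v\<^sub>0 k (A_op V E v\<^sub>0 l s)) i =
        D_op V E v\<^sub>0 (A_op V E v\<^sub>0 l (A_op V E v\<^sub>0 k s)) i"
    proof (cases "i \<in> index_set V E v\<^sub>0")
      case True
      \<comment> \<open>For \<open>j\<close> outside the index set nothing is assumed, but the
        sphere is empty and both sides are 0.\<close>
      have "Poly_Mapping.lookup (conv (conv (xvar j) (xvar l)) (xvar k)) i *
            (\<Sum>y\<in>gsphere V E j v\<^sub>0. s y) =
          Poly_Mapping.lookup (conv (conv (xvar j) (xvar k)) (xvar l)) i *
            (\<Sum>y\<in>gsphere V E j v\<^sub>0. s y)" for j
        using R by (cases "j \<in> index_set V E v\<^sub>0") (auto simp: index_set_iff)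
      then have "(\<Sum>j\<le>i + k + l. Poly_Mapping.lookup (conv (conv (xvar j) (xvar l)) (xvar k)) i *
            (\<Sum>y\<in>gsphere V E j v\<^sub>0. s y)) =
          (\<Sum>j\<le>i + k + l. Poly_Mapping.lookup (conv (conv (xvar j) (xvar k)) (xvar l)) i *
            (\<Sum>y\<in>gsphere V E j v\<^sub>0. s y))"
        by (rule sum.cong[OF refl])
      then show ?thesis
        using True k l by (simp add: D_A_A_op[where N = "i + k + l"])
    \<comment> \<open>Outside the index set both families are \<open>undefined\<close>.\<close>
    qed (simp add: D_op_def)
  qed
qed

end

theorem theorem3p9:
  fixes V :: "'a set" and E :: "('a \<times> 'a) set" and v\<^sub>0 :: 'a
  assumes "pointed_graph V E v\<^sub>0"
    and "cond_S1 V E v\<^sub>0"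
    and "cond_S2 V E v\<^sub>0"
  shows "hypergroup_productive V E v\<^sub>0 \<longleftrightarrow>
    (\<forall>k\<in>index_set V E v\<^sub>0. \<forall>l\<in>index_set V E v\<^sub>0. \<forall>s\<in>V \<rightarrow>\<^sub>E (UNIV :: complex set).
      D_op V E v\<^sub>0 (A_op V E v\<^sub>0 k (A_op V E v\<^sub>0 l s)) =
      D_op V E v\<^sub>0 (A_op V E v\<^sub>0 l (A_op V E v\<^sub>0 k s)))"
proof -
  interpret sphere_regular_graph V E v\<^sub>0
    using assms by (simp add: sphere_regular_graph_def sphere_regular_graph_axioms_def)
  show ?thesis
    unfolding hypergroup_productive_iff using D_A_A_op_commute_iff by blast
qed

end
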